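(* Let $d:\mathbb{R}\to\mathbb{R}$ be an additive function, let $I\subseteq\mathbb{R}$ be a nonempty open interval not containing zero, and assume that $P,Q:I\to\mathbb{R}$ are of the form $$P(u)=\sum_{k\in\mathbb{Z}}p_ku^k,\qquad Q(u)=\sum_{k\in\mathbb{Z}}q_ku^k,$$ where $p_k,q_k\in\mathbb{Q}$ for all $k\in\mathbb{Z}$ and the set $\{k\in\mathbb{Z}\mid(p_k,q_k)\neq(0,0)\}$ is finite. Then $$Q'(u)\,d(P(u))=P'(u)\,d(Q(u))\qquad(u\in I)$$ holds if and only if one of the following conditions holds: (i) $P$ and $Q$ are linearly dependent; (ii) $P$ and $Q$ are linearly independent, $P-p_0$ and $Q-q_0$ are linearly dependent, and $d(1)=0$; (iii) $P-p_0$ and $Q-q_0$ are linearly independent and $d$ is a standard derivation.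
   Context: A function $d:\mathbb{R}\to\mathbb{R}$ is additive if $d(x+y)=d(x)+d(y)$ for all $x,y\in\mathbb{R}$. It is a standard derivation if it is additive and satisfies $d(xy)=d(x)y+x\,d(y)$ for all $x,y\in\mathbb{R}$. Linear (in)dependence is that of real-valued functions on $I$, over $\mathbb{R}$. Here $p_0$ and $q_0$ are the coefficients of $u^0$ in $P$ and $Q$. *)

theory Defs
  imports "HOL-Analysis.Analysis"
begin

definition standard_derivation :: "(real \<Rightarrow> real) \<Rightarrow> bool" where
  "standard_derivation d \<longleftrightarrow>
     Modules.additive d \<and> (\<forall>x y. d (x * y) = d x * y + x * d y)"

(* The pair (f, g) is tested, not the set {f, g}: in particular (f, f) is dependent,
   although {f} is an independent set when f is nonzero on S. *)
definition lin_dependent_on :: "real set \<Rightarrow> (real \<Rightarrow> real) \<Rightarrow> (real \<Rightarrow> real) \<Rightarrow> bool" where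
  "lin_dependent_on S f g \<longleftrightarrow>
     (\<exists>a b :: real. (a, b) \<noteq> (0, 0) \<and> (\<forall>u\<in>S. a * f u + b * g u = 0))"

end

theory Submission
  imports Defs
begin

text \<open>
  Write \<open>D j k = p j * q k - q j * p k\<close> for the minors of the coefficient columns. Since \<open>d\<close> is
  \<open>\<rat>\<close>-linear and the coefficients are rational, the equation at \<open>u\<close>, multiplied by \<open>u\<close>, says that
  the sum of \<open>j * D j k * u powi j * d (u powi k)\<close> over all \<open>j, k\<close> vanishes
  (\<open>equation_iff_minor_sum\<close>). The three cases of the theorem are conditions on the same
  minors: linear dependence of \<open>P, Q\<close> means that all minors vanish, and that of \<open>P - p 0, Q - q 0\<close>
  that all minors with nonzero indices vanish (\<open>lin_dependent_on_iff_minors_zero\<close>). From this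
  the conditions are readily seen to be sufficient: with all minors zero nothing is left of the sum;
  when \<open>d 1 = 0\<close>, the terms with \<open>j = 0\<close> or \<open>k = 0\<close> vanish by themselves; and if \<open>d\<close> is a derivation,
  then \<open>u * d (u powi k) = k * u powi k * d u\<close>, which makes the summand antisymmetric in \<open>j, k\<close>.

  For necessity, fix \<open>v \<noteq> 0\<close> and put \<open>u = r * v\<close> with \<open>r\<close> rational. The sum becomes a Laurent
  polynomial in \<open>r\<close> with infinitely many zeros, so that for each \<open>n\<close> the terms with \<open>j + k = n\<close>
  already add up to zero, now at every \<open>v \<noteq> 0\<close> (\<open>homogeneous_minor_sums\<close>). If some minor is
  nonzero, then a suitable degree contains only one nonzero minor up to order
  (\<open>leading_minor\<close>), say \<open>D N m\<close>, and what remains is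
  \<open>N * v powi N * d (v powi m) = m * v powi m * d (v powi N)\<close>. At \<open>v = 1\<close> this gives \<open>d 1 = 0\<close>.
  Hence the index \<open>0\<close> may be dropped from the sum, and if some minor with nonzero indices does not
  vanish, the same argument yields such a relation with \<open>N, m\<close> nonzero and distinct. Such a
  relation forces \<open>d\<close> to be a derivation (\<open>derivation_if_proportional_powers\<close>).
\<close>

section \<open>Laurent polynomials with infinitely many zeros\<close>

text \<open>
  Multiplication by a high power of \<open>x\<close> reduces this to polynomials.
\<close>

lemma Laurent_coeffs_zero:
  fixes c :: "int \<Rightarrow> real"
  assumes fin: "finite K" and inf: "infinite X"
    and zero: "\<And>x. x \<in> X \<Longrightarrow> x \<noteq> 0 \<and> (\<Sum>k\<in>K. c k * x powi k) = 0"
    and n: "n \<in> K"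
  shows "c n = 0"
proof -
  obtain M where M: "\<And>k. k \<in> K \<Longrightarrow> - M \<le> k"
    using bounded_imp_bdd_below fin finite_imp_bounded
    by (metis add.inverse_inverse bdd_below.E bdd_below_finite)
  define f where "f = (\<Sum>k\<in>K. monom (c k) (nat (k + M)))"
  have root: "poly f x = 0" if "x \<in> X" for x
  proof -
    have x: "x \<noteq> 0" using zero that by blast
    have "poly f x = (\<Sum>k\<in>K. x powi M * (c k * x powi k))"
      unfolding f_def poly_sum poly_monom
    proof (rule sum.cong)
      fix k assume "k \<in> K"
      then have "x ^ nat (k + M) = x powi (k + M)"
        using M[of k] by (simp add: power_int_def)
      then show "c k * x ^ nat (k + M) = x powi M * (c k * x powi k)"
        using x by (simp add: power_int_add)
    qed simp
    also have "\<dots> = 0" using zero[OF that] by (simp flip: sum_distrib_left)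
    finally show ?thesis .
  qed
  have "f = 0"
    using poly_roots_finite[of f] inf root by (metis (mono_tags, lifting) finite_subset mem_Collect_eq subsetI)
  then have "0 = coeff f (nat (n + M))" by simp
  also have "\<dots> = (\<Sum>k\<in>K. if k = n then c k else 0)"
    unfolding f_def coeff_sum coeff_monom
  proof (rule sum.cong)
    fix k assume "k \<in> K"
    then show "(if nat (k + M) = nat (n + M) then c k else 0) = (if k = n then c k else 0)"
      using M[of k] M[OF n] by auto
  qed simp
  also have "\<dots> = c n" using n fin by simp
  finally show ?thesis by simp
qed

text \<open>
  The exponents \<open>e\<close> may repeat, as the degrees \<open>j + k\<close> do in a double sum.
\<close>

lemma homogeneous_parts_zero:
  fixes c :: "'a \<Rightarrow> real" and e :: "'a \<Rightarrow> int"
  assumes fin: "finite A" and inf: "infinite X"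
    and zero: "\<And>x. x \<in> X \<Longrightarrow> x \<noteq> 0 \<and> (\<Sum>i\<in>A. c i * x powi e i) = 0"
  shows "(\<Sum>i | i \<in> A \<and> e i = n. c i) = 0"
proof (cases "n \<in> e ` A")
  case True
  show ?thesis
  proof (rule Laurent_coeffs_zero[of "e ` A" X, OF _ inf _ True])
    fix x assume x: "x \<in> X"
    have "(\<Sum>k\<in>e ` A. (\<Sum>i | i \<in> A \<and> e i = k. c i) * x powi k)
        = (\<Sum>k\<in>e ` A. \<Sum>i | i \<in> A \<and> e i = k. c i * x powi e i)"
      by (simp add: sum_distrib_right)
    also have "\<dots> = (\<Sum>i\<in>A. c i * x powi e i)"
      using fin by (intro sum.group) auto
    finally show "x \<noteq> 0 \<and> (\<Sum>k\<in>e ` A. (\<Sum>i | i \<in> A \<and> e i = k. c i) * x powi k) = 0"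
      using zero[OF x] by simp
  qed (use fin in simp)
next
  case False
  then have "{i. i \<in> A \<and> e i = n} = {}" by auto
  then show ?thesis by (simp only: sum.empty)
qed

lemma infinite_rats_in_open:
  fixes U :: "real set"
  assumes "open U" "U \<noteq> {}"
  shows "infinite (U \<inter> \<rat>)"
proof
  assume fin: "finite (U \<inter> \<rat>)"
  have "open (U - U \<inter> \<rat>)" using assms fin by (simp add: finite_imp_closed open_Diff)
  moreover have "U - U \<inter> \<rat> \<noteq> {}"
    using assms fin by (metis Diff_eq_empty_iff finite_subset finite_imp_not_open)
  ultimately obtain x e where "e > 0" "ball x e \<subseteq> U - U \<inter> \<rat>"
    by (metis ex_in_conv open_contains_ball)
  moreover obtain r where "r \<in> \<rat>" "x < r" "r < x + e"
    using Rats_dense_in_real[of x "x + e"] \<open>e > 0\<close> by auto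
  moreover have "r \<in> ball x e" using calculation by (simp add: dist_real_def)
  ultimately show False by blast
qed

section \<open>Minors of a pair of coefficient sequences\<close>

definition minor :: "(int \<Rightarrow> real) \<Rightarrow> (int \<Rightarrow> real) \<Rightarrow> int \<Rightarrow> int \<Rightarrow> real" where
  "minor p q j k = p j * q k - q j * p k"

lemma minor_antisym: "minor p q k j = - minor p q j k"
  by (simp add: minor_def)

lemma minor_same [simp]: "minor p q k k = 0"
  by (simp add: minor_def)

text \<open>
  Dependence is over \<open>\<real>\<close> and of functions on \<open>I\<close>, but the powers of \<open>u\<close> are independent on the
  infinite set \<open>I\<close>; so it amounts to the coefficient matrix with rows \<open>p\<close> and \<open>q\<close> having rank at
  most one.
\<close>

lemma lin_dependent_on_iff_minors_zero:
  assumes I: "open I" "I \<noteq> {}" "0 \<notin> I" and fin: "finite S"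
    and F: "\<And>u. u \<in> I \<Longrightarrow> F u = (\<Sum>k\<in>S. p k * u powi k)"
    and G: "\<And>u. u \<in> I \<Longrightarrow> G u = (\<Sum>k\<in>S. q k * u powi k)"
  shows "lin_dependent_on I F G \<longleftrightarrow> (\<forall>j\<in>S. \<forall>k\<in>S. minor p q j k = 0)"
proof -
  have comb: "a * F u + b * G u = (\<Sum>k\<in>S. (a * p k + b * q k) * u powi k)" if "u \<in> I" for a b u
    using that by (simp add: F G sum_distrib_left sum.distrib algebra_simps)
  show ?thesis
  proof
    assume "lin_dependent_on I F G"
    then obtain a b where ab: "(a, b) \<noteq> (0, 0)" and z: "\<And>u. u \<in> I \<Longrightarrow> a * F u + b * G u = 0"
      unfolding lin_dependent_on_def by blast
    have rel: "a * p k + b * q k = 0" if "k \<in> S" for k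
    proof (rule Laurent_coeffs_zero[of S I, OF fin _ _ that])
      show "infinite I" using I finite_imp_not_open by blast
      show "u \<noteq> 0 \<and> (\<Sum>k\<in>S. (a * p k + b * q k) * u powi k) = 0" if "u \<in> I" for u
        using that I z comb by auto
    qed
    show "\<forall>j\<in>S. \<forall>k\<in>S. minor p q j k = 0"
    proof (intro ballI)
      fix j k assume "j \<in> S" "k \<in> S"
      then have r: "a * p j + b * q j = 0" "a * p k + b * q k = 0" using rel by auto
      have "a * minor p q j k = 0" "b * minor p q j k = 0"
        using r unfolding minor_def by algebra+
      then show "minor p q j k = 0" using ab by auto
    qed
  next
    assume m: "\<forall>j\<in>S. \<forall>k\<in>S. minor p q j k = 0"
    show "lin_dependent_on I F G"
    proof (cases "\<exists>j\<in>S. (p j, q j) \<noteq> (0, 0)")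
      case True
      then obtain j where j: "j \<in> S" "(p j, q j) \<noteq> (0, 0)" by blast
      have "(- q j) * F u + p j * G u = 0" if "u \<in> I" for u
      proof -
        have "(- q j) * p k + p j * q k = 0" if "k \<in> S" for k
          using m j(1) that by (auto simp: minor_def)
        then show ?thesis unfolding comb[OF that] by (intro sum.neutral) simp
      qed
      then show ?thesis unfolding lin_dependent_on_def
        using j(2) by (intro exI[of _ "- q j"] exI[of _ "p j"]) auto
    next
      case False
      then show ?thesis unfolding lin_dependent_on_def
        by (intro exI[of _ 1] exI[of _ 0]) (simp add: F)
    qed
  qed
qed

text \<open>
  Choose \<open>N\<close> maximal among the indices that occur in a nonzero minor, and then \<open>m\<close> maximal with
  \<open>minor p q N m \<noteq> 0\<close>. By maximality, any other \<open>a, b\<close> of the same degree with a nonzero minor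
  would lie strictly between \<open>m\<close> and \<open>N\<close>; but then the columns \<open>a\<close> and \<open>b\<close> are both proportional to
  the nonzero column \<open>N\<close>, and their minor vanishes after all.
\<close>

lemma leading_minor:
  assumes fin: "finite S" and ex: "j \<in> S" "k \<in> S" "minor p q j k \<noteq> 0"
  obtains N m where "N \<in> S" "m \<in> S" "N \<noteq> m" "minor p q N m \<noteq> 0"
    "\<And>a b. a \<in> S \<Longrightarrow> b \<in> S \<Longrightarrow> a + b = N + m \<Longrightarrow> minor p q a b \<noteq> 0 \<Longrightarrow>
       (a, b) = (N, m) \<or> (a, b) = (m, N)"
proof -
  define R where "R = {a \<in> S. \<exists>b\<in>S. minor p q a b \<noteq> 0}"
  define N where "N = Max R"
  have R: "finite R" "R \<noteq> {}" using assms by (auto simp: R_def)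
  have N: "N \<in> R" and Nmax: "\<And>a. a \<in> R \<Longrightarrow> a \<le> N"
    using R by (auto simp: N_def)
  define C where "C = {b \<in> S. minor p q N b \<noteq> 0}"
  define m where "m = Max C"
  have C: "finite C" "C \<noteq> {}" using N fin by (auto simp: C_def R_def)
  have m: "m \<in> C" and mmax: "\<And>b. b \<in> C \<Longrightarrow> b \<le> m"
    using C by (auto simp: m_def)
  have Nm: "minor p q N m \<noteq> 0" using m by (simp add: C_def)
  show ?thesis
  proof (rule that[of N m])
    show "N \<in> S" "m \<in> S" using N m by (auto simp: R_def C_def)
    show "N \<noteq> m" using Nm by auto
    show "minor p q N m \<noteq> 0" by fact
    fix a b assume ab: "a \<in> S" "b \<in> S" "a + b = N + m" "minor p q a b \<noteq> 0"
    have "minor p q b a \<noteq> 0" using ab(4) minor_antisym[of p q b a] by simp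
    then have "a \<in> R" "b \<in> R" using ab unfolding R_def by blast+
    then have le: "a \<le> N" "b \<le> N" using Nmax by auto
    show "(a, b) = (N, m) \<or> (a, b) = (m, N)"
    proof (rule ccontr)
      assume "\<not> ?thesis"
      then have "m < a" "m < b" using le ab(3) by auto
      then have "minor p q N a = 0" "minor p q N b = 0"
        using mmax[of a] mmax[of b] ab by (auto simp: C_def)
      \<comment> \<open>the Pluecker relation of the columns \<open>N, m, a, b\<close>\<close>
      moreover have "minor p q N m * minor p q a b
          = minor p q N a * minor p q m b - minor p q N b * minor p q m a"
        by (simp add: minor_def algebra_simps)
      ultimately show False using Nm ab(4) by simp
    qed
  qed
qed

section \<open>Additive functions\<close>

lemma additive_of_rat:
  fixes d :: "real \<Rightarrow> real"
  assumes "Modules.additive d"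
  shows "d (of_rat r * x) = of_rat r * d x"
proof -
  interpret additive d by fact
  have nat: "d (of_nat n * y) = of_nat n * d y" for n y
    by (induction n) (simp_all add: algebra_simps add zero)
  have int: "d (of_int n * y) = of_int n * d y" for n y
    by (cases n) (simp_all only: of_int_minus of_int_of_nat_eq minus nat mult_minus_left)
  obtain a b where r: "r = of_int a / of_int b" "b > 0" by (metis quotient_of_div quotient_of_denom_pos surj_pair)
  have "of_int b * d (of_rat r * x) = d (of_int b * (of_rat r * x))" by (simp add: int)
  also have "of_int b * (of_rat r * x) = of_int a * x"
    using r by (simp add: of_rat_divide)
  also have "d \<dots> = of_int a * d x" by (rule int)
  also have "\<dots> = of_int b * (of_rat r * d x)"
    using r by (simp add: of_rat_divide)
  finally show ?thesis using r(2) by simp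
qed

lemma additive_Rats:
  fixes d :: "real \<Rightarrow> real"
  assumes "Modules.additive d" "r \<in> \<rat>"
  shows "d (r * x) = r * d x"
  using assms additive_of_rat by (metis Rats_cases)

text \<open>
  Polarization: compare the values of \<open>d\<close> at the two sides of the expansion of \<open>(x + y) ^ 2\<close>.
\<close>

lemma standard_derivation_if_square:
  fixes d :: "real \<Rightarrow> real"
  assumes additive: "Modules.additive d" and sq: "\<And>x. d (x ^ 2) = 2 * x * d x"
  shows "standard_derivation d"
  unfolding standard_derivation_def
proof (intro conjI allI additive)
  fix x y :: real
  interpret additive d by fact
  have "(x + y) ^ 2 = x ^ 2 + (x * y + x * y) + y ^ 2" by (simp add: power2_eq_square algebra_simps)
  then have "d ((x + y) ^ 2) = d (x ^ 2) + (d (x * y) + d (x * y)) + d (y ^ 2)"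
    by (simp only: add)
  then show "d (x * y) = d x * y + x * d y"
    by (simp add: sq add algebra_simps)
qed

lemma derivation_one:
  assumes "standard_derivation d" shows "d 1 = 0"
proof -
  have "d (1 * 1) = d 1 * 1 + 1 * d 1" using assms unfolding standard_derivation_def by blast
  then show ?thesis by simp
qed

lemma derivation_power_int:
  assumes d: "standard_derivation d" and u: "u \<noteq> 0"
  shows "d (u powi k) = of_int k * u powi (k - 1) * d u"
proof -
  have prod: "d (x * y) = d x * y + x * d y" for x y
    using d by (simp add: standard_derivation_def)
  have pos: "d (u ^ n) * u = of_nat n * u ^ n * d u" for n
    by (induction n) (simp_all add: derivation_one[OF d] prod algebra_simps)
  have main: "d (u powi k) * u = of_int k * u powi k * d u"
  proof (cases "k \<ge> 0")
    case True
    then show ?thesis using pos[of "nat k"] by (simp add: power_int_def)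
  next
    case False
    define n where "n = nat (- k)"
    have k: "k = - int n" using False by (simp add: n_def)
    have "d (u powi k * u ^ n) = 0"
      using u by (simp add: k power_int_minus derivation_one[OF d])
    then have "(d (u powi k) * u) * u ^ n + u powi k * (d (u ^ n) * u) = 0"
      by (simp add: prod algebra_simps) (metis distrib_left mult_zero_right)
    then have "(d (u powi k) * u) * u ^ n = (of_int k * u powi k * d u) * u ^ n"
      unfolding pos by (simp add: k algebra_simps)
    then show ?thesis using u by simp
  qed
  then show ?thesis using u by (simp add: power_int_diff field_simps)
qed

text \<open>
  Substitute \<open>v = 1 + s * u\<close> with \<open>s\<close> rational: both sides become polynomials in \<open>s\<close> whose
  coefficients involve the numbers \<open>d (u ^ i)\<close>. Because \<open>d 1 = 0\<close>, the coefficients of \<open>s\<close> agree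
  trivially; those of \<open>s ^ 2\<close> give \<open>m * l * (m - l) * (d (u ^ 2) - 2 * u * d u) = 0\<close>.
\<close>

lemma derivation_if_distinct_powers:
  fixes m l :: nat and d :: "real \<Rightarrow> real"
  assumes additive: "Modules.additive d" and one: "d 1 = 0"
    and ml: "m > 0" "l > 0" "m \<noteq> l"
    and eq: "\<And>v::real. v \<noteq> 0 \<Longrightarrow> l * v ^ l * d (v ^ m) = m * v ^ m * d (v ^ l)"
  shows "standard_derivation d"
proof (rule standard_derivation_if_square[OF additive])
  fix u :: real
  interpret additive d by fact
  \<comment> \<open>\<open>B c n\<close> is the binomial expansion of \<open>(1 + s * u) ^ n\<close> as a polynomial in \<open>s\<close>, with \<open>u ^ i\<close>
    replaced by \<open>c i\<close>: so \<open>c i = d (u ^ i)\<close> gives the image under \<open>d\<close> when \<open>s\<close> is rational\<close>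
  define B :: "(nat \<Rightarrow> real) \<Rightarrow> nat \<Rightarrow> real poly" where
    "B c n = (\<Sum>i\<le>n. monom (of_nat (n choose i) * c i) i)" for c n
  have coeff: "coeff (B c n) i = of_nat (n choose i) * c i" for c n i
    by (simp add: B_def coeff_sum)
  have binom: "(1 + s * u) ^ n = (\<Sum>i\<le>n. of_nat (n choose i) * u ^ i * s ^ i)" for s n
    using binomial_ring[of "s * u" 1 n] by (simp add: power_mult_distrib mult_ac add.commute)
  have B1: "poly (B (\<lambda>i. u ^ i) n) s = (1 + s * u) ^ n" for s n
    by (simp add: binom B_def poly_sum poly_monom)
  have B2: "poly (B (\<lambda>i. d (u ^ i)) n) s = d ((1 + s * u) ^ n)" if "s \<in> \<rat>" for s n
  proof -
    have "d (of_nat (n choose i) * u ^ i * s ^ i) = of_nat (n choose i) * d (u ^ i) * s ^ i" for i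
      using additive_Rats[OF additive, of "of_nat (n choose i) * s ^ i" "u ^ i"] that
      by (simp add: mult_ac)
    then show ?thesis by (simp add: binom sum B_def poly_sum poly_monom)
  qed
  define f where "f = smult l (B (\<lambda>i. u ^ i) l * B (\<lambda>i. d (u ^ i)) m)
    - smult m (B (\<lambda>i. u ^ i) m * B (\<lambda>i. d (u ^ i)) l)"
  have "infinite ({s. 1 + s * u \<noteq> 0} \<inter> \<rat>)"
  proof (rule infinite_rats_in_open)
    show "open {s. 1 + s * u \<noteq> 0}" by (intro open_Collect_neq continuous_intros)
    show "{s. 1 + s * u \<noteq> 0} \<noteq> {}" by (auto intro: exI[of _ 0])
  qed
  moreover have "({s. 1 + s * u \<noteq> 0} \<inter> \<rat>) \<subseteq> {s. poly f s = 0}"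
  proof
    fix s assume "s \<in> {s. 1 + s * u \<noteq> 0} \<inter> \<rat>"
    then show "s \<in> {s. poly f s = 0}"
      using eq[of "1 + s * u"] by (simp add: f_def B1 B2 mult.assoc)
  qed
  ultimately have "f = 0" using poly_roots_finite finite_subset by metis
  then have "coeff f 2 = 0" by simp
  then have "l * (l * u * (m * d u) + (m choose 2) * d (u ^ 2))
      = m * (m * u * (l * d u) + (l choose 2) * d (u ^ 2))"
    by (simp add: f_def coeff_mult coeff numeral_2_eq_2 one add.commute)
  moreover have ch: "real (n choose 2) = n * (real n - 1) / 2" for n
    by (cases n) (simp_all add: choose_two real_of_nat_div algebra_simps)
  ultimately have "(real m * l * (real m - l)) * (d (u ^ 2) - 2 * u * d u) = 0"
    by (simp add: ch field_simps)
  then show "d (u ^ 2) = 2 * u * d u" using ml by simp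
qed

text \<open>
  The rule for reciprocals yields the rule for squares by applying \<open>d\<close> to the partial fraction
  decomposition \<open>1 / v - 1 / (v + 1) = 1 / (v ^ 2 + v)\<close>.
\<close>

lemma derivation_if_inverse:
  fixes d :: "real \<Rightarrow> real"
  assumes additive: "Modules.additive d" and one: "d 1 = 0"
    and inv: "\<And>v. v > 0 \<Longrightarrow> d (1 / v) = - d v / v ^ 2"
  shows "standard_derivation d"
proof (rule standard_derivation_if_square[OF additive])
  interpret additive d by fact
  have pos: "d (v ^ 2) = 2 * v * d v" if v: "v > 0" for v
  proof -
    have "d (1 / v) - d (1 / (v + 1)) = d (1 / (v ^ 2 + v))"
      using v by (simp flip: diff) (simp add: field_simps power2_eq_square)
    also have "\<dots> = - (d (v ^ 2) + d v) / (v ^ 2 + v) ^ 2"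
      using v by (subst inv) (auto simp: add intro!: add_pos_pos)
    finally have "- d v / v ^ 2 + d v / (v + 1) ^ 2 = - (d (v ^ 2) + d v) / (v ^ 2 * (v + 1) ^ 2)"
      using v by (simp add: inv add one power2_eq_square algebra_simps)
    then have "- d v * (v + 1) ^ 2 + d v * v ^ 2 = - (d (v ^ 2) + d v)"
      using v by (simp add: divide_simps split: if_splits)
    then show ?thesis by (simp add: power2_eq_square algebra_simps)
  qed
  fix u :: real
  consider "u > 0" | "u = 0" | "- u > 0"
    by (cases u "0::real" rule: linorder_cases) auto
  then show "d (u ^ 2) = 2 * u * d u"
  proof cases
    case 3
    then show ?thesis using pos[of "- u"] by (simp add: minus)
  qed (use pos zero in auto)
qed

text \<open>
  Using the hypothesis at \<open>v powi N\<close> and at \<open>v powi k\<close> and eliminating \<open>d (v powi (N * k))\<close>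
  replaces the exponents \<open>N, k\<close> of arbitrary sign by the positive ones \<open>N ^ 2, k ^ 2\<close>. These are
  distinct unless \<open>N = - k\<close>, and in that case taking roots leaves the rule for reciprocals.
\<close>

lemma derivation_if_proportional_powers:
  fixes N k :: int and d :: "real \<Rightarrow> real"
  assumes additive: "Modules.additive d" and one: "d 1 = 0"
    and Nk: "N \<noteq> 0" "k \<noteq> 0" "N \<noteq> k"
    and eq: "\<And>v. v \<noteq> 0 \<Longrightarrow> N * v powi N * d (v powi k) = k * v powi k * d (v powi N)"
  shows "standard_derivation d"
proof (cases "N = - k")
  case True
  show ?thesis
  proof (rule derivation_if_inverse[OF additive one])
    fix v :: real assume v: "v > 0"
    define w where "w = v powr (1 / k)"
    \<comment> \<open>every positive number is a \<open>k\<close>-th power\<close>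
    have w: "w > 0" "w powi k = v"
      using v Nk by (simp_all add: w_def powr_powr flip: powr_real_of_int')
    have "- real_of_int k * (1 / v) * d v = k * v * d (1 / v)"
      using eq[of w] w True by (simp add: power_int_minus field_simps)
    then have "real_of_int k * (v * d (1 / v) + d v / v) = 0" by (simp add: algebra_simps)
    then have "v * d (1 / v) = - d v / v" using Nk by simp
    then show "d (1 / v) = - d v / v ^ 2" using v by (simp add: field_simps power2_eq_square)
  qed
next
  case False
  show ?thesis
  proof (rule derivation_if_distinct_powers[OF additive one])
    show "nat (N ^ 2) > 0" "nat (k ^ 2) > 0" using Nk by simp_all
    show "nat (N ^ 2) \<noteq> nat (k ^ 2)" using Nk False by (simp add: eq_nat_nat_iff power2_eq_iff)
    fix v :: real assume v: "v \<noteq> 0"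
    define A where "A = v powi (N * k)"
    have A: "A \<noteq> 0" using v by (simp add: A_def)
    have 1: "N * v ^ nat (N ^ 2) * d A = k * A * d (v ^ nat (N ^ 2))"
      using eq[of "v powi N"] v
      by (simp add: A_def power_int_def[of v "N ^ 2"] power2_eq_square flip: power_int_mult)
         (simp add: power_int_def mult_ac)
    have 2: "N * A * d (v ^ nat (k ^ 2)) = k * v ^ nat (k ^ 2) * d A"
      using eq[of "v powi k"] v
      by (simp add: A_def mult.commute power2_eq_square flip: power_int_mult)
         (simp add: power_int_def mult_ac)
    have "A * (real_of_int k ^ 2 * v ^ nat (k ^ 2) * d (v ^ nat (N ^ 2)))
        = k * v ^ nat (k ^ 2) * (k * A * d (v ^ nat (N ^ 2)))"
      by (simp add: power2_eq_square[of "real_of_int k"] mult_ac)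
    also have "\<dots> = N * v ^ nat (N ^ 2) * (k * v ^ nat (k ^ 2) * d A)"
      unfolding 1[symmetric] by (simp only: mult_ac)
    also have "\<dots> = A * (real_of_int N ^ 2 * v ^ nat (N ^ 2) * d (v ^ nat (k ^ 2)))"
      unfolding 2[symmetric] power2_eq_square[of "real_of_int N"] by (simp only: mult_ac)
    finally have "A * (real_of_int k ^ 2 * v ^ nat (k ^ 2) * d (v ^ nat (N ^ 2)))
        = A * (real_of_int N ^ 2 * v ^ nat (N ^ 2) * d (v ^ nat (k ^ 2)))" .
    then show "real (nat (k ^ 2)) * v ^ nat (k ^ 2) * d (v ^ nat (N ^ 2))
        = real (nat (N ^ 2)) * v ^ nat (N ^ 2) * d (v ^ nat (k ^ 2))"
      using A by simp
  qed
qed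

section \<open>The equation as a family of homogeneous equations\<close>

lemma deriv_Laurent:
  assumes "open I" "0 \<notin> I" "u \<in> I" "finite S"
    and F: "\<And>u. u \<in> I \<Longrightarrow> F u = (\<Sum>k\<in>S. c k * u powi k)"
  shows "deriv F u = (\<Sum>k\<in>S. c k * (of_int k * u powi (k - 1)))"
proof -
  have u: "u \<noteq> 0" using assms by auto
  have "((\<lambda>u. \<Sum>k\<in>S. c k * u powi k) has_field_derivative
      (\<Sum>k\<in>S. c k * (of_int k * u powi (k - 1)))) (at u)"
    using u by (auto intro!: derivative_eq_intros simp: mult_ac)
  then have "(F has_field_derivative (\<Sum>k\<in>S. c k * (of_int k * u powi (k - 1)))) (at u)"
    by (rule has_field_derivative_transform_within_open[OF _ assms(1,3)]) (simp add: F)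
  then show ?thesis by (rule DERIV_imp_deriv)
qed

text \<open>
  In the degree singled out by the leading minor, only the summands \<open>(N, m)\<close> and \<open>(m, N)\<close> survive,
  and antisymmetry lets the minor be cancelled.
\<close>

lemma proportional_powers:
  assumes fin: "finite S"
    and hom: "\<And>n v. v \<noteq> 0 \<Longrightarrow>
      (\<Sum>(j, k) | (j, k) \<in> S \<times> S \<and> j + k = n.
            of_int j * minor p q j k * v powi j * d (v powi k)) = 0"
    and ex: "j0 \<in> S" "k0 \<in> S" "minor p q j0 k0 \<noteq> 0"
  obtains N m :: int where "N \<in> S" "m \<in> S" "N \<noteq> m"
    "\<And>v. v \<noteq> 0 \<Longrightarrow> N * v powi N * d (v powi m) = m * v powi m * d (v powi N)"
proof -
  obtain N m where Nm: "N \<in> S" "m \<in> S" "N \<noteq> m" "minor p q N m \<noteq> 0"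
    and uniq: "\<And>a b. a \<in> S \<Longrightarrow> b \<in> S \<Longrightarrow> a + b = N + m \<Longrightarrow> minor p q a b \<noteq> 0 \<Longrightarrow>
       (a, b) = (N, m) \<or> (a, b) = (m, N)"
    using leading_minor[OF fin ex] by blast
  show ?thesis
  proof (rule that[OF Nm(1-3)])
    fix v :: real assume v: "v \<noteq> 0"
    let ?t = "\<lambda>(j, k). of_int j * minor p q j k * v powi j * d (v powi k)"
    have "0 = sum ?t {(j, k). (j, k) \<in> S \<times> S \<and> j + k = N + m}"
      using hom[OF v, of "N + m"] by (simp add: case_prod_unfold)
    also have "\<dots> = sum ?t {(N, m), (m, N)}"
    proof (rule sum.mono_neutral_right)
      show "finite {(j, k). (j, k) \<in> S \<times> S \<and> j + k = N + m}"
        using fin by (auto intro: finite_subset[of _ "S \<times> S"])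
      show "\<forall>i\<in>{(j, k). (j, k) \<in> S \<times> S \<and> j + k = N + m} - {(N, m), (m, N)}. ?t i = 0"
        using uniq by fastforce
    qed (use Nm in auto)
    also have "\<dots> = minor p q N m * (N * v powi N * d (v powi m) - m * v powi m * d (v powi N))"
      using Nm(3) minor_antisym[of p q m N] by (simp add: algebra_simps)
    finally show "N * v powi N * d (v powi m) = m * v powi m * d (v powi N)"
      using Nm(4) by simp
  qed
qed

text \<open>
  Rationality of the coefficients enters here, where \<open>d\<close> is moved past them. The right-hand side
  carries an additional factor \<open>u\<close>, so that its terms have degree \<open>j + k\<close>.
\<close>

lemma equation_iff_minor_sum:
  fixes p q :: "int \<Rightarrow> rat"
  assumes additive: "Modules.additive d" and I: "open I" "0 \<notin> I" "u \<in> I" and fin: "finite S"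
    and P: "\<And>u. u \<in> I \<Longrightarrow> P u = (\<Sum>k\<in>S. of_rat (p k) * u powi k)"
    and Q: "\<And>u. u \<in> I \<Longrightarrow> Q u = (\<Sum>k\<in>S. of_rat (q k) * u powi k)"
  shows "deriv Q u * d (P u) = deriv P u * d (Q u) \<longleftrightarrow>
    (\<Sum>(j, k)\<in>S \<times> S. of_int j * minor (of_rat \<circ> p) (of_rat \<circ> q) j k * u powi j * d (u powi k)) = 0"
proof -
  interpret additive d by fact
  have u: "u \<noteq> 0" using I by auto
  have d: "d (\<Sum>k\<in>S. of_rat (c k) * u powi k) = (\<Sum>k\<in>S. of_rat (c k) * d (u powi k))" for c
    by (simp add: sum additive_of_rat[OF additive])
  have D: "u * deriv P u = (\<Sum>j\<in>S. of_rat (p j) * (of_int j * u powi j))"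
    "u * deriv Q u = (\<Sum>j\<in>S. of_rat (q j) * (of_int j * u powi j))"
    using u
    by (simp_all add: deriv_Laurent[OF I fin P] deriv_Laurent[OF I fin Q] sum_distrib_left power_int_diff)
  have "deriv Q u * d (P u) = deriv P u * d (Q u)
      \<longleftrightarrow> (u * deriv P u) * d (Q u) - (u * deriv Q u) * d (P u) = 0"
    using u by auto
  also have "(u * deriv P u) * d (Q u) - (u * deriv Q u) * d (P u)
      = (\<Sum>j\<in>S. \<Sum>k\<in>S. of_int j * minor (of_rat \<circ> p) (of_rat \<circ> q) j k * u powi j * d (u powi k))"
    unfolding D P[OF I(3)] Q[OF I(3)] d sum_product
    by (simp flip: sum_subtractf) (simp add: minor_def algebra_simps)
  finally show ?thesis by (simp add: sum.cartesian_product)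
qed

text \<open>
  Rational multiples of a given \<open>v \<noteq> 0\<close> meet \<open>I\<close> infinitely often, and
  \<open>d ((r * v) powi k) = r powi k * d (v powi k)\<close> for rational \<open>r\<close>. Thus the equation on \<open>I\<close> has
  consequences for all nonzero reals.
\<close>

lemma homogeneous_minor_sums:
  assumes additive: "Modules.additive d" and I: "open I" "0 \<notin> I" "I \<noteq> {}" and fin: "finite S"
    and eq: "\<And>u. u \<in> I \<Longrightarrow>
      (\<Sum>(j, k)\<in>S \<times> S. of_int j * minor p q j k * u powi j * d (u powi k)) = 0"
    and v: "v \<noteq> 0"
  shows "(\<Sum>(j, k) | (j, k) \<in> S \<times> S \<and> j + k = n.
            of_int j * minor p q j k * v powi j * d (v powi k)) = 0"
proof -
  define X where "X = {r. r * v \<in> I} \<inter> \<rat>"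
  have "infinite X" unfolding X_def
  proof (rule infinite_rats_in_open)
    show "open {r. r * v \<in> I}"
      using continuous_open_vimage[of I "\<lambda>r. r * v"] I(1)
      by (simp add: vimage_def)
    obtain w where "w \<in> I" using I by auto
    then have "w / v \<in> {r. r * v \<in> I}" using v by simp
    then show "{r. r * v \<in> I} \<noteq> {}" by blast
  qed
  have "(\<Sum>i | i \<in> S \<times> S \<and> fst i + snd i = n.
      of_int (fst i) * minor p q (fst i) (snd i) * v powi fst i * d (v powi snd i)) = 0"
  proof (rule homogeneous_parts_zero[OF _ \<open>infinite X\<close>])
    fix r assume r: "r \<in> X"
    then have rv: "r * v \<in> I" "r \<in> \<rat>" and r0: "r \<noteq> 0" using I by (auto simp: X_def)
    have d: "d (r powi k * v powi k) = r powi k * d (v powi k)" for k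
    proof -
      have "r powi k \<in> \<rat>" using rv(2) by (simp add: power_int_def)
      then show ?thesis by (rule additive_Rats[OF additive])
    qed
    show "r \<noteq> 0 \<and> (\<Sum>i\<in>S \<times> S. of_int (fst i) * minor p q (fst i) (snd i) * v powi fst i
        * d (v powi snd i) * r powi (fst i + snd i)) = 0"
      using r0 eq[OF rv(1)] unfolding power_int_mult_distrib d
      by (simp add: power_int_add case_prod_unfold mult_ac)
  qed (use fin in simp)
  then show ?thesis by (simp add: case_prod_unfold mem_Times_iff)
qed

theorem theorem8:
  fixes d P Q :: "real \<Rightarrow> real" and I :: "real set" and p q :: "int \<Rightarrow> rat"
  assumes "Modules.additive d"
    and "open I" and "is_interval I" and "I \<noteq> {}" and "0 \<notin> I"
    and "finite {k. (p k, q k) \<noteq> (0, 0)}"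
    and "\<And>u. u \<in> I \<Longrightarrow> P u = (\<Sum>k | (p k, q k) \<noteq> (0, 0). of_rat (p k) * u powi k)"
    and "\<And>u. u \<in> I \<Longrightarrow> Q u = (\<Sum>k | (p k, q k) \<noteq> (0, 0). of_rat (q k) * u powi k)"
  shows "(\<forall>u\<in>I. deriv Q u * d (P u) = deriv P u * d (Q u)) \<longleftrightarrow>
    lin_dependent_on I P Q \<or>
    (\<not> lin_dependent_on I P Q \<and>
     lin_dependent_on I (\<lambda>u. P u - of_rat (p 0)) (\<lambda>u. Q u - of_rat (q 0)) \<and> d 1 = 0) \<or>
    (\<not> lin_dependent_on I (\<lambda>u. P u - of_rat (p 0)) (\<lambda>u. Q u - of_rat (q 0)) \<and>
     standard_derivation d)"
proof -
  define S where "S = {k. (p k, q k) \<noteq> (0, 0)}"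
  let ?p = "of_rat \<circ> p :: int \<Rightarrow> real" and ?q = "of_rat \<circ> q :: int \<Rightarrow> real"
  let ?D = "minor ?p ?q"
  let ?P0 = "\<lambda>u. P u - of_rat (p 0)" and ?Q0 = "\<lambda>u. Q u - of_rat (q 0)"
  let ?t = "\<lambda>u (j, k). real_of_int j * ?D j k * u powi j * d (u powi k)"
  have fin: "finite S" using assms(6) by (simp add: S_def)
  have P: "P u = (\<Sum>k\<in>S. of_rat (p k) * u powi k)"
    and Q: "Q u = (\<Sum>k\<in>S. of_rat (q k) * u powi k)" if "u \<in> I" for u
    using that assms(7,8) unfolding S_def by auto
  have dep: "lin_dependent_on I P Q \<longleftrightarrow> (\<forall>j\<in>S. \<forall>k\<in>S. ?D j k = 0)"
    by (rule lin_dependent_on_iff_minors_zero[OF assms(2,4,5) fin]) (simp_all add: P Q)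
  have drop: "(\<Sum>k\<in>S. of_rat (c k) * u powi k) - of_rat (c 0) = (\<Sum>k\<in>S - {0}. of_rat (c k) * u powi k)"
    if "0 \<notin> S \<Longrightarrow> c 0 = 0" for c :: "int \<Rightarrow> rat" and u :: real
    using that fin by (simp add: sum_diff1)
  have S0: "p 0 = 0" "q 0 = 0" if "0 \<notin> S"
    using that by (simp_all add: S_def)
  have dep0: "lin_dependent_on I ?P0 ?Q0 \<longleftrightarrow> (\<forall>j\<in>S - {0}. \<forall>k\<in>S - {0}. ?D j k = 0)"
    by (rule lin_dependent_on_iff_minors_zero[OF assms(2,4,5)])
      (use fin in \<open>simp_all add: P Q drop S0\<close>)
  have main: "(\<forall>u\<in>I. deriv Q u * d (P u) = deriv P u * d (Q u)) \<longleftrightarrow> (\<forall>u\<in>I. sum (?t u) (S \<times> S) = 0)"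
    using equation_iff_minor_sum[OF assms(1,2,5) _ fin P Q] by simp
  show ?thesis unfolding main
  proof
    assume eq: "\<forall>u\<in>I. sum (?t u) (S \<times> S) = 0"
    have hom: "(\<Sum>(j, k) | (j, k) \<in> S \<times> S \<and> j + k = n.
            of_int j * ?D j k * v powi j * d (v powi k)) = 0" if "v \<noteq> 0" for n v
      using homogeneous_minor_sums[OF assms(1,2,5,4) fin _ that, of ?p ?q n] eq by simp
    show "lin_dependent_on I P Q \<or> (\<not> lin_dependent_on I P Q \<and> lin_dependent_on I ?P0 ?Q0 \<and> d 1 = 0) \<or>
      (\<not> lin_dependent_on I ?P0 ?Q0 \<and> standard_derivation d)"
    proof (cases "lin_dependent_on I P Q")
      case False
      then obtain j k where jk: "j \<in> S" "k \<in> S" "?D j k \<noteq> 0" using dep by blast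
      obtain N m :: int where "N \<in> S" "m \<in> S" "N \<noteq> m" and
        Nm: "\<And>v. v \<noteq> 0 \<Longrightarrow> N * v powi N * d (v powi m) = m * v powi m * d (v powi N)"
        by (rule proportional_powers[where S = S and p = ?p and q = ?q and d = d, OF fin _ jk])
          (rule hom, assumption, rule that)
      then have one: "d 1 = 0" using Nm[of 1] by simp
      have "standard_derivation d" if indep0: "\<not> lin_dependent_on I ?P0 ?Q0"
      proof -
        obtain j k where jk: "j \<in> S - {0}" "k \<in> S - {0}" "?D j k \<noteq> 0"
          using dep0 indep0 by blast
        \<comment> \<open>a term with \<open>j = 0\<close> carries the factor \<open>0\<close>, one with \<open>k = 0\<close> the factor \<open>d 1 = 0\<close>\<close>
        have hom0: "(\<Sum>(j, k) | (j, k) \<in> (S - {0}) \<times> (S - {0}) \<and> j + k = n.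
            of_int j * ?D j k * v powi j * d (v powi k)) = 0"
          if "v \<noteq> 0" for n v
        proof -
          have "(\<Sum>(j, k) | (j, k) \<in> (S - {0}) \<times> (S - {0}) \<and> j + k = n.
            of_int j * ?D j k * v powi j * d (v powi k))
            = (\<Sum>(j, k) | (j, k) \<in> S \<times> S \<and> j + k = n.
            of_int j * ?D j k * v powi j * d (v powi k))"
          proof (rule sum.mono_neutral_left)
            show "finite {(j, k). (j, k) \<in> S \<times> S \<and> j + k = n}"
              using fin by (auto intro: finite_subset[of _ "S \<times> S"])
          qed (auto simp: one)
          then show ?thesis using hom[OF that] by simp
        qed
        obtain N m :: int where Nm: "N \<in> S - {0}" "m \<in> S - {0}" "N \<noteq> m"
          "\<And>v. v \<noteq> 0 \<Longrightarrow> N * v powi N * d (v powi m) = m * v powi m * d (v powi N)"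
          by (rule proportional_powers[where S = "S - {0}" and p = ?p and q = ?q and d = d,
            OF finite_Diff[OF fin] _ jk])
            (rule hom0, assumption, rule that)
        then show ?thesis
          by (intro derivation_if_proportional_powers[OF assms(1) one, of N m]) auto
      qed
      then show ?thesis using False one by blast
    qed simp
  next
    assume "lin_dependent_on I P Q \<or> (\<not> lin_dependent_on I P Q \<and> lin_dependent_on I ?P0 ?Q0 \<and> d 1 = 0) \<or>
      (\<not> lin_dependent_on I ?P0 ?Q0 \<and> standard_derivation d)"
    then consider "lin_dependent_on I P Q" | "lin_dependent_on I ?P0 ?Q0" "d 1 = 0"
      | "standard_derivation d" by blast
    then show "\<forall>u\<in>I. sum (?t u) (S \<times> S) = 0"
    proof cases
      case 1
      then show ?thesis unfolding dep by (auto intro!: sum.neutral)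
    next
      case 2
      have "?t u (j, k) = 0" if "j \<in> S" "k \<in> S" for u j k
        using that 2 unfolding dep0 by (cases "j = 0"; cases "k = 0") auto
      then show ?thesis by (auto intro!: sum.neutral)
    next
      case 3
      show ?thesis
      proof
        fix u assume "u \<in> I"
        then have u: "u \<noteq> 0" using assms(5) by auto
        have d: "u * d (u powi k) = of_int k * u powi k * d u" for k
          using u by (simp add: derivation_power_int[OF 3 u] power_int_diff)
        \<comment> \<open>for a derivation the summand is antisymmetric, so the double sum equals its negative\<close>
        define s where "s = (\<lambda>(j, k). u * ?t u (j, k))"
        have s: "s (j, k) = ?D j k * (of_int j * of_int k * (u powi j * u powi k * d u))" for j k
        proof -
          have "s (j, k) = ?D j k * (of_int j * u powi j * (u * d (u powi k)))"
            by (simp only: s_def prod.case mult_ac)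
          then show ?thesis by (simp only: d mult_ac)
        qed
        have anti: "s (k, j) = - s (j, k)" for j k
          unfolding s minor_antisym[of ?p ?q k j] by (simp only: mult_ac mult_minus_left mult_minus_right)
        have "sum s (S \<times> S) = (\<Sum>j\<in>S. \<Sum>k\<in>S. s (k, j))"
          unfolding sum.cartesian_product' by (rule sum.swap)
        also have "\<dots> = (\<Sum>j\<in>S. \<Sum>k\<in>S. - s (j, k))"
          by (intro sum.cong refl anti)
        also have "\<dots> = - sum s (S \<times> S)"
          unfolding sum.cartesian_product' by (simp only: sum_negf)
        finally have "sum s (S \<times> S) = 0" by simp
        then have "u * sum (?t u) (S \<times> S) = 0"
          by (simp add: s_def sum_distrib_left case_prod_unfold)
        then show "sum (?t u) (S \<times> S) = 0" using u by simp
      qed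
    qed
  qed
qed

end
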